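(* Let $K$ be a field and let $g(n)=b_0+b_1n+\cdots+b_rn^r$ for $n\in\mathbb{N}$, where $b_0,\ldots,b_r\in K$. Then $$\sum_{n=0}^{\infty}g(n)x^n=b_0F_{C_0}(x)+\sum_{i=1}^rb_i\,x\,F_{C_i}(x).$$
   Context: $\mathbb{N}=\{0,1,2,\ldots\}$. For $d\ge 1$, $C_d=[0,1]^d\subset\mathbb{R}^d$ is the $d$-th unit cube, and $C_0=\mathrm{conv}(\{1\})$ is a single lattice point. For a lattice polytope $\mathcal{P}\subset\mathbb{R}^s$, its Ehrhart function is $E_{\mathcal{P}}(n)=|n\mathcal{P}\cap\mathbb{Z}^s|$ for $n\in\mathbb{N}$, and its Ehrhart series is $F_{\mathcal{P}}(x)=\sum_{n=0}^\infty E_{\mathcal{P}}(n)x^n$. In particular $F_{C_0}(x)=1/(1-x)$. The identity is one of power series in $x$ with coefficients in $K$ (integers being viewed in $K$). *)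

theory Defs
  imports "HOL-Analysis.Analysis" "HOL-Analysis.Finite_Function_Topology"
    "HOL-Computational_Algebra.Formal_Power_Series"
begin

text \<open>
  The dimension of the cubes varies inside a single sum, so \<open>\<real>\<^sup>s\<close> cannot be a type.  It is
  the subspace of those vectors in the real vector space \<^typ>\<open>nat \<Rightarrow>\<^sub>0 real\<close> of finitely
  supported functions whose coordinates with index outside \<open>{..<s}\<close> vanish.
\<close>

definition real_space :: "nat \<Rightarrow> (nat \<Rightarrow>\<^sub>0 real) set" where
  "real_space s = {x. Poly_Mapping.keys x \<subseteq> {..<s}}"

text \<open>
  The intersection with \<^term>\<open>real_space s\<close> is \<open>\<int>\<^sup>s\<close>.
\<close>

definition integer_points :: "(nat \<Rightarrow>\<^sub>0 real) set" where
  "integer_points = {x. \<forall>i. Poly_Mapping.lookup x i \<in> \<int>}"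

text \<open>
  If \<open>P\<close> is contained in \<^term>\<open>real_space s\<close>, then so are its dilates, and their points in
  \<^term>\<open>integer_points\<close> are their points in \<open>\<int>\<^sup>s\<close>; the Ehrhart function therefore does not
  need the ambient dimension as an argument.  It is intended for lattice polytopes; there the
  set being counted is finite.
\<close>

definition ehrhart :: "(nat \<Rightarrow>\<^sub>0 real) set \<Rightarrow> nat \<Rightarrow> nat" where
  "ehrhart P n = card ((\<lambda>x. real n *\<^sub>R x) ` P \<inter> integer_points)"

definition ehrhart_series :: "(nat \<Rightarrow>\<^sub>0 real) set \<Rightarrow> 'a::semiring_1 fps" where
  "ehrhart_series P = Abs_fps (\<lambda>n. of_nat (ehrhart P n))"

text \<open>
  The case \<open>d = 0\<close> is the lattice point \<open>1\<close> of the line \<^term>\<open>real_space 1\<close>, not the origin.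
\<close>

definition unit_cube :: "nat \<Rightarrow> (nat \<Rightarrow>\<^sub>0 real) set" where
  "unit_cube d =
    (if d = 0 then convex hull {Poly_Mapping.single 0 1}
     else {x \<in> real_space d. \<forall>i<d. Poly_Mapping.lookup x i \<in> {0..1}})"

end

theory Submission
  imports Defs
begin

text \<open>The dilate of a \<open>d\<close>-cube by \<open>n\<close> is the box with all
  \<open>d\<close> coordinates in [0,n], so it has (n+1)^d lattice points
  (\<open>dilate_unit_cube\<close>, \<open>ehrhart_unit_cube\<close>). Multiplying its series by
  \<open>fps_X\<close> shifts (n+1)^d to n^d and puts 0 = 0^d in degree 0, which is right exactly
  for d > 0. The constant term of the polynomial has 0^0 = 1 in degree 0, so it takes the unshifted
  series of \<open>unit_cube 0\<close>, whose coefficients are all 1. The identity follows by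
  comparing coefficients.\<close>

lemma lookup_scaleR: "Poly_Mapping.lookup (c *\<^sub>R x) i = c *\<^sub>R Poly_Mapping.lookup x i"
proof -
  have "finite {i. c *\<^sub>R Poly_Mapping.lookup x i \<noteq> 0}"
    by (rule finite_subset[OF _ finite_keys[of x]]) (auto simp: in_keys_iff)
  then show ?thesis
    by (simp add: scaleR_poly_mapping_def)
qed

lemma dilate_unit_cube:
  assumes "d > 0"
  shows "(\<lambda>x. real n *\<^sub>R x) ` unit_cube d =
    {x \<in> real_space d. \<forall>i<d. Poly_Mapping.lookup x i \<in> {0..real n}}"
    (is "?L = ?R")
proof
  show "?L \<subseteq> ?R"
    using assms
    by (auto simp: unit_cube_def real_space_def in_keys_iff subset_iff lookup_scaleR mult_left_le)
next
  show "?R \<subseteq> ?L"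
  proof
    fix x assume x: "x \<in> ?R"
    \<comment> \<open>The preimage is x/n. For n = 0 the convention \<open>inverse 0 = 0\<close>
      makes it the origin, which suffices because the box then contains only 0.\<close>
    have "x = real n *\<^sub>R (inverse (real n) *\<^sub>R x)"
    proof (cases "n = 0")
      case True
      have "Poly_Mapping.lookup x i = 0" for i
        using x True by (cases "i < d") (auto simp: real_space_def in_keys_iff subset_iff)
      then have "x = 0"
        by (intro poly_mapping_eqI) simp
      then show ?thesis by simp
    qed simp
    moreover have "inverse (real n) * Poly_Mapping.lookup x i \<le> 1" if "i < d" for i
      using x that by (cases "n = 0") (auto simp: field_simps)
    then have "inverse (real n) *\<^sub>R x \<in> unit_cube d"
      using x assms
      by (auto simp: unit_cube_def real_space_def in_keys_iff subset_iff lookup_scaleR)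
    ultimately show "x \<in> ?L" by (rule image_eqI)
  qed
qed

text \<open>For d > 0, lattice points of the dilate correspond to functions from
  \<open>{..<d}\<close> to \<open>{..n}\<close>. For d = 0 the dilate is the single integer point n
  of the line, and the count 1 equals (n+1)^0.\<close>

lemma ehrhart_unit_cube: "ehrhart (unit_cube d) n = (n + 1) ^ d"
proof (cases "d = 0")
  case True
  then have "(\<lambda>x. real n *\<^sub>R x) ` unit_cube d \<inter> integer_points =
      {real n *\<^sub>R Poly_Mapping.single 0 1}"
    \<comment> \<open>Rewriting \<open>single 0 1\<close> to the ring unit would hide its
      coordinates.\<close>
    by (auto simp: unit_cube_def integer_points_def lookup_scaleR lookup_single when_def
        simp del: single_one)
  then show ?thesis
    using True by (simp add: ehrhart_def)
next
  case False
  \<comment> \<open>Cutting off at \<open>d\<close> gives finite support; the functions in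
    \<open>PiE\<close> are \<open>undefined\<close>, not 0, outside \<open>{..<d}\<close>.\<close>
  define h :: "(nat \<Rightarrow> nat) \<Rightarrow> (nat \<Rightarrow>\<^sub>0 real)"
    where "h k = Abs_poly_mapping (\<lambda>i. if i < d then real (k i) else 0)" for k
  have lookup_h: "Poly_Mapping.lookup (h k) i = (if i < d then real (k i) else 0)" for k i
    unfolding h_def by (subst Abs_poly_mapping_inverse) auto
  have "inj_on h ({..<d} \<rightarrow>\<^sub>E {..n})"
  proof (rule inj_onI)
    fix k l assume k: "k \<in> {..<d} \<rightarrow>\<^sub>E {..n}" and l: "l \<in> {..<d} \<rightarrow>\<^sub>E {..n}" and "h k = h l"
    then have "k i = l i" if "i < d" for i
      using lookup_h[of k i] lookup_h[of l i] that by simp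
    then show "k = l"
      by (intro PiE_ext[OF k l]) simp
  qed
  moreover have "(\<lambda>x. real n *\<^sub>R x) ` unit_cube d \<inter> integer_points = h ` ({..<d} \<rightarrow>\<^sub>E {..n})"
    (is "?L = ?R")
  proof
    show "?R \<subseteq> ?L"
    proof
      fix x assume "x \<in> ?R"
      then obtain k where k: "\<And>i. i < d \<Longrightarrow> k i \<le> n" and x: "x = h k"
        by (auto simp: PiE_iff)
      have "Poly_Mapping.keys x \<subseteq> {..<d}"
        by (auto simp: x in_keys_iff lookup_h split: if_splits)
      then show "x \<in> ?L"
        using k False by (simp add: dilate_unit_cube real_space_def integer_points_def x lookup_h)
    qed
  next
    show "?L \<subseteq> ?R"
    proof
      fix x assume "x \<in> ?L"
      then have keys: "Poly_Mapping.keys x \<subseteq> {..<d}"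
        and bounds: "\<And>i. i < d \<Longrightarrow> 0 \<le> Poly_Mapping.lookup x i \<and> Poly_Mapping.lookup x i \<le> real n"
        and int: "\<And>i. Poly_Mapping.lookup x i \<in> \<int>"
        using False by (simp_all add: dilate_unit_cube real_space_def integer_points_def)
      \<comment> \<open>The coordinates are nonnegative integers, so the floor loses nothing;
        \<open>restrict\<close> supplies the extensionality that \<open>PiE\<close> demands.\<close>
      define k where "k = restrict (\<lambda>i. nat \<lfloor>Poly_Mapping.lookup x i\<rfloor>) {..<d}"
      have "nat \<lfloor>Poly_Mapping.lookup x i\<rfloor> \<le> n" if "i < d" for i
        using bounds[OF that] by linarith
      then have "k \<in> {..<d} \<rightarrow>\<^sub>E {..n}"
        by (simp add: k_def PiE_iff)
      moreover have "x = h k"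
      proof (rule poly_mapping_eqI)
        fix i show "Poly_Mapping.lookup x i = Poly_Mapping.lookup (h k) i"
        proof (cases "i < d")
          case True
          then show ?thesis
            using bounds[OF True] int[of i] by (simp add: lookup_h k_def)
        next
          case False
          then have "i \<notin> Poly_Mapping.keys x"
            using keys by auto
          then show ?thesis
            using False by (simp add: lookup_h in_keys_iff)
        qed
      qed
      ultimately show "x \<in> ?R" by blast
    qed
  qed
  ultimately show ?thesis
    by (simp add: ehrhart_def card_image card_PiE)
qed

theorem lemma3p2:
  fixes b :: "nat \<Rightarrow> 'k::field" and r :: nat and g :: "nat \<Rightarrow> 'k"
  assumes "\<And>n. g n = (\<Sum>i\<le>r. b i * of_nat n ^ i)"
  shows "Abs_fps g =
    fps_const (b 0) * ehrhart_series (unit_cube 0) +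
    (\<Sum>i=1..r. fps_const (b i) * fps_X * ehrhart_series (unit_cube i))"
proof (rule fps_ext)
  fix n
  have "g n = b 0 + (\<Sum>i=1..r. b i * of_nat n ^ i)"
    by (simp add: assms atMost_atLeast0 sum.atLeast_Suc_atMost)
  then show "fps_nth (Abs_fps g) n = fps_nth (fps_const (b 0) * ehrhart_series (unit_cube 0) +
      (\<Sum>i=1..r. fps_const (b i) * fps_X * ehrhart_series (unit_cube i))) n"
    \<comment> \<open>At n = 0 the shifted terms vanish, as do the powers 0^i with i > 0. At n = m+1
      the shift reads off the coefficient (m+1)^i = n^i.\<close>
    by (cases n)
      (simp_all add: fps_sum_nth mult.assoc ehrhart_series_def ehrhart_unit_cube add.commute power_0_left)
qed

end
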